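(* Let $F$ be a non-abelian free group, let $\Delta$ be a decomposition of $F$ and let $\phi, \psi \colon F \to \mathbb{R}$ be quasimorphisms such that $\phi$ is $\Delta$-decomposable and $\psi$ is $\Delta$-continuous. Then $[\delta^1 \phi] \smile [\delta^1 \psi] \in \mathrm{H}^4_b(F, \mathbb{R})$ is trivial.
   Context: $F$ is a non-abelian free group on a fixed free generating set. Bounded cohomology. $C^k(F,\mathbb{R})$ is the set of all functions $F^k\to\mathbb{R}$ and $C^k_b(F,\mathbb{R})$ the subset of bounded functions. The coboundary is $\delta^n(\alpha)(g_1,\ldots,g_{n+1}) = \alpha(g_2,\ldots,g_{n+1}) + \sum_{j=1}^n (-1)^j \alpha(g_1,\ldots,g_jg_{j+1},\ldots,g_{n+1}) + (-1)^{n+1}\alpha(g_1,\ldots,g_n)$. $\mathrm{H}^*_b(F,\mathbb{R})$ is the homology of $(C^*_b(F,\mathbb{R}),\delta^* )$. The cup product is induced by $(\omega_1\smile\omega_2)(g_1,\ldots,g_{n+m})=\omega_1(g_1,\ldots,g_n)\,\omega_2(g_{n+1},\ldots,g_{n+m})$. A quasimorphism is a map $\alpha\colon F\to\mathbb{R}$ with $\delta^1\alpha$ bounded; it is symmetric if $\alpha(g^{-1})=-\alpha(g)$ for all $g$. Sequences. A set $\mathcal{P}\subset F$ is symmetric if $p\in\mathcal{P}$ implies $p^{-1}\in\mathcal{P}$. $\mathcal{P}^*$ is the set of finite (possibly empty) sequences in $\mathcal{P}$. For $(\underline{a})=(a_1,\ldots,a_k)$, $(\underline{a}^{-1})=(a_k^{-1},\ldots,a_1^{-1})$.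 The dot denotes concatenation. The common sequence of two sequences is their longest common initial segment (possibly empty). A product $a_1\cdots a_k$ in $F$ is said to be reduced (no cancellation) if concatenating the reduced words of $a_1,\ldots,a_k$ gives a reduced word. Decompositions. Let $\mathcal{P}\subset F$ be a symmetric set (the pieces) not containing the identity. A decomposition of $F$ into the pieces $\mathcal{P}$ is a map $\Delta\colon F\to\mathcal{P}^*$ such that: (1) for every $g$ with $\Delta(g)=(g_1,\ldots,g_k)$, $g=g_1\cdots g_k$ as a reduced word, and $\Delta(g^{-1})=(g_k^{-1},\ldots,g_1^{-1})$; (2) for such $g$, $\Delta(g_i\cdots g_j)=(g_i,\ldots,g_j)$ for $1\le i\le j\le k$; (3) there is a constant $R>0$ such that the following holds for all $g,h\in F$. Let $(\underline{c}_1^{-1})$ be the common sequence of $\Delta(g)$ and $\Delta(gh)$, $(\underline{c}_2^{-1})$ that of $\Delta(g^{-1})$ and $\Delta(h)$, and $(\underline{c}_3^{-1})$ that of $\Delta(h^{-1})$ and $\Delta(h^{-1}g^{-1})$. Then there are $(\underline{r}_1),(\underline{r}_2),(\underline{r}_3)\in\mathcal{P}^*$ with $\Delta(g)=(\underline{c}_1^{-1})\cdot(\underline{r}_1)\cdot(\underline{c}_2)$, $\Delta(h)=(\underline{c}_2^{-1})\cdot(\underline{r}_2)\cdot(\underline{c}_3)$, $\Delta(h^{-1}g^{-1})=(\underline{c}_3^{-1})\cdot(\underline{r}_3)\cdot(\underline{c}_1)$; the requirement is that the lengths of $(\underline{r}_1),(\underline{r}_2),(\underline{r}_3)$ are at most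 $R$. The $(\underline{c}_j)$ and $(\underline{r}_j)$ are called the $c$-part and $r$-part of the $\Delta$-triangle of $(g,h)$. $\Delta$-decomposable. Let $\lambda\colon\mathcal{P}\to\mathbb{R}$ be bounded with $\lambda(p^{-1})=-\lambda(p)$. The map $\phi_{\lambda,\Delta}(g)=\sum_{j=1}^k\lambda(g_j)$, where $\Delta(g)=(g_1,\ldots,g_k)$, is called a $\Delta$-decomposable quasimorphism. $\Delta$-continuous. For $(g,h),(g',h')\in F^2$ with $\Delta$-triangles $(\underline{c}_j),(\underline{r}_j)$ and $(\underline{c}'_j),(\underline{r}'_j)$, where $(\underline{c}_j)=(c_{j,1},\ldots,c_{j,n_j})$ and $(\underline{c}'_j)=(c'_{j,1},\ldots,c'_{j,n'_j})$, define $N_\Delta((g,h),(g',h'))$ as follows: it is $\infty$ if $(g,h)=(g',h')$; it is $0$ if $(\underline{r}_j)\neq(\underline{r}'_j)$ for some $j\in\{1,2,3\}$; otherwise it is the largest integer $N$ such that, for every $j\in\{1,2,3\}$ with $(\underline{c}_j)\neq(\underline{c}'_j)$, one has $N\le\min\{n_j,n'_j\}$ and $c_{j,k}=c'_{j,k}$ for all $k\le N$. A quasimorphism $\psi$ is $\Delta$-continuous if it is symmetric and there is a non-negative summable sequence $(s_j)_{j\ge 0}$ such that, with $\omega=\delta^1\psi$, for all $(g,h)\neq(g',h')$ in $F^2$, $|\omega(g,h)-\omega(g',h')|\le s_N$ where $N=N_\Delta((g,h),(g',h'))$. *)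

theory Defs
  imports Complex_Main "HOL-Algebra.Coset" "HOL-Library.Sublist"
    "HOL-Library.FuncSet" "HOL-Library.Extended_Nat"
begin

section \<open>The free group on a set\<close>

text \<open>A letter is a generator \<open>(x, True)\<close> or the formal inverse \<open>(x, False)\<close> of one.
  The free group on \<open>X\<close> is the set of reduced words in these letters.  Hence the elements of the
  group are their own reduced words.\<close>

type_synonym 'a word = "('a \<times> bool) list"

definition letter_inv :: "'a \<times> bool \<Rightarrow> 'a \<times> bool" where
  "letter_inv p = (fst p, \<not> snd p)"

definition reduced_word :: "'a word \<Rightarrow> bool" where
  "reduced_word w \<longleftrightarrow> successively (\<lambda>p q. q \<noteq> letter_inv p) w"

fun push_letter :: "'a \<times> bool \<Rightarrow> 'a word \<Rightarrow> 'a word" where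
  "push_letter p [] = [p]"
| "push_letter p (q # w) = (if q = letter_inv p then w else p # q # w)"

definition normal_form :: "'a word \<Rightarrow> 'a word" where
  "normal_form w = foldr push_letter w []"

definition free_group :: "'a set \<Rightarrow> 'a word monoid" where
  "free_group X =
    \<lparr>carrier = {w. set w \<subseteq> X \<times> UNIV \<and> reduced_word w},
     mult = (\<lambda>u v. normal_form (u @ v)),
     one = []\<rparr>"

lemma letter_inv_invol [simp]: "letter_inv (letter_inv p) = p"
  by (simp add: letter_inv_def)

lemma reduced_word_Cons:
  "reduced_word (p # w) \<longleftrightarrow> reduced_word w \<and> (w = [] \<or> hd w \<noteq> letter_inv p)"
  by (cases w) (auto simp: reduced_word_def)

lemma reduced_word_Nil [simp]: "reduced_word []"
  by (simp add: reduced_word_def)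

lemma reduced_push: "reduced_word w \<Longrightarrow> reduced_word (push_letter p w)"
  by (cases w) (auto simp: reduced_word_Cons)

lemma set_push: "set (push_letter p w) \<subseteq> insert p (set w)"
  by (cases w) auto

lemma push_cancel: "reduced_word w \<Longrightarrow> push_letter (letter_inv p) (push_letter p w) = w"
proof (cases w)
  case (Cons q v)
  assume "reduced_word w"
  with Cons show ?thesis by (cases v) (auto simp: reduced_word_def)
qed auto

lemma reduced_foldr: "reduced_word v \<Longrightarrow> reduced_word (foldr push_letter u v)"
  by (induction u) (auto intro: reduced_push)

lemma set_foldr: "set (foldr push_letter u v) \<subseteq> set u \<union> set v"
  using set_push by (induction u) fastforce+

lemma normal_form_reduced: "reduced_word w \<Longrightarrow> normal_form w = w"
proof (induction w)
  case (Cons p w)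
  then show ?case by (cases w) (auto simp: reduced_word_Cons normal_form_def)
qed (simp add: normal_form_def)

lemma foldr_push:
  "reduced_word w \<Longrightarrow> reduced_word u \<Longrightarrow>
    foldr push_letter (push_letter p u) w = push_letter p (foldr push_letter u w)"
proof (cases u)
  case (Cons q v)
  assume "reduced_word w"
  then have "push_letter (letter_inv (letter_inv p)) (push_letter (letter_inv p)
      (foldr push_letter v w)) = foldr push_letter v w"
    by (intro push_cancel reduced_foldr)
  with Cons show ?thesis by auto
qed simp

lemma foldr_normal_form:
  assumes "reduced_word w"
  shows "foldr push_letter (normal_form u) w = foldr push_letter u w"
proof (induction u)
  case (Cons p u)
  have "reduced_word (normal_form u)"
    by (simp add: normal_form_def reduced_foldr)
  with Cons assms show ?case by (simp add: normal_form_def foldr_push)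
qed (simp add: normal_form_def)

lemma foldr_word_inv:
  assumes "reduced_word w"
  shows "foldr push_letter (rev (map letter_inv u)) (foldr push_letter u w) = w"
proof (induction u)
  case (Cons p u)
  have "push_letter (letter_inv p) (push_letter p (foldr push_letter u w)) = foldr push_letter u w"
    using assms by (intro push_cancel reduced_foldr)
  with Cons show ?case by simp
qed simp

lemma group_free_group: "group (free_group X)"
proof (rule groupI)
  have red: "reduced_word (normal_form w)" for w :: "'a word"
    by (simp add: normal_form_def reduced_foldr)
  have nf: "normal_form (u @ v) = foldr push_letter u v" if "reduced_word v" for u v :: "'a word"
    using normal_form_reduced[OF that] by (simp add: normal_form_def)
  show "x \<otimes>\<^bsub>free_group X\<^esub> y \<in> carrier (free_group X)"
    if "x \<in> carrier (free_group X)" "y \<in> carrier (free_group X)" for x y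
  proof -
    have "set (normal_form (x @ y)) \<subseteq> set x \<union> set y"
      using set_foldr[of "x @ y" "[]"] by (simp add: normal_form_def)
    with that red[of "x @ y"] show ?thesis by (simp add: free_group_def) blast
  qed
  show "\<one>\<^bsub>free_group X\<^esub> \<in> carrier (free_group X)"
    by (simp add: free_group_def)
  show "x \<otimes>\<^bsub>free_group X\<^esub> y \<otimes>\<^bsub>free_group X\<^esub> z = x \<otimes>\<^bsub>free_group X\<^esub> (y \<otimes>\<^bsub>free_group X\<^esub> z)"
    if "x \<in> carrier (free_group X)" "y \<in> carrier (free_group X)" "z \<in> carrier (free_group X)"
    for x y z
    using that foldr_normal_form[of z "x @ y"] reduced_foldr[of z y]
    by (auto simp: free_group_def nf)
  show "\<one>\<^bsub>free_group X\<^esub> \<otimes>\<^bsub>free_group X\<^esub> x = x" if "x \<in> carrier (free_group X)" for x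
    using that by (simp add: free_group_def normal_form_reduced)
  show "\<exists>y\<in>carrier (free_group X). y \<otimes>\<^bsub>free_group X\<^esub> x = \<one>\<^bsub>free_group X\<^esub>"
    if x: "x \<in> carrier (free_group X)" for x
  proof
    let ?y = "normal_form (rev (map letter_inv x))"
    show "?y \<in> carrier (free_group X)"
    proof -
      have "set ?y \<subseteq> letter_inv ` set x"
        using set_foldr[of "rev (map letter_inv x)" "[]"] by (simp add: normal_form_def)
      moreover have "letter_inv ` set x \<subseteq> X \<times> UNIV"
        using x by (auto simp: free_group_def letter_inv_def)
      ultimately show ?thesis using red[of "rev (map letter_inv x)"]
        by (auto simp: free_group_def)
    qed
    have "foldr push_letter x [] = x"
      using x normal_form_reduced[of x] by (simp add: free_group_def normal_form_def)
    then show "?y \<otimes>\<^bsub>free_group X\<^esub> x = \<one>\<^bsub>free_group X\<^esub>"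
      using x foldr_normal_form[of x "rev (map letter_inv x)"] foldr_word_inv[of "[]" x]
      by (auto simp: free_group_def nf)
  qed
qed


section \<open>Bounded cohomology of a group with real coefficients\<close>

text \<open>An \<open>n\<close>-cochain is a function on lists of length \<open>n\<close> over the carrier; outside these lists it
  is \<open>undefined\<close>, so that cochains are equal iff they agree on all \<open>n\<close>-tuples.\<close>

definition tuples :: "('g, 'm) monoid_scheme \<Rightarrow> nat \<Rightarrow> 'g list set" where
  "tuples G n = {xs. length xs = n \<and> set xs \<subseteq> carrier G}"

definition bounded_cochains :: "('g, 'm) monoid_scheme \<Rightarrow> nat \<Rightarrow> ('g list \<Rightarrow> real) monoid" where
  "bounded_cochains G n =
    \<lparr>carrier = {\<alpha> \<in> extensional (tuples G n). \<exists>K. \<forall>xs\<in>tuples G n. \<bar>\<alpha> xs\<bar> \<le> K},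
     mult = (\<lambda>\<alpha> \<beta>. \<lambda>xs\<in>tuples G n. \<alpha> xs + \<beta> xs),
     one = (\<lambda>xs\<in>tuples G n. 0)\<rparr>"

text \<open>\<open>merge G j [g\<^sub>1, \<dots>, g\<^sub>m] = [g\<^sub>1, \<dots>, g\<^sub>j \<otimes> g\<^sub>j\<^sub>+\<^sub>1, \<dots>, g\<^sub>m]\<close>, counting from 1.\<close>

definition merge :: "('g, 'm) monoid_scheme \<Rightarrow> nat \<Rightarrow> 'g list \<Rightarrow> 'g list" where
  "merge G j xs = take (j - 1) xs @ [xs ! (j - 1) \<otimes>\<^bsub>G\<^esub> xs ! j] @ drop (j + 1) xs"

definition coboundary ::
    "('g, 'm) monoid_scheme \<Rightarrow> nat \<Rightarrow> ('g list \<Rightarrow> real) \<Rightarrow> 'g list \<Rightarrow> real" where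
  "coboundary G n \<alpha> = (\<lambda>xs\<in>tuples G (n + 1).
     \<alpha> (tl xs) + (\<Sum>j=1..n. (- 1) ^ j * \<alpha> (merge G j xs)) + (- 1) ^ (n + 1) * \<alpha> (butlast xs))"

definition bounded_cocycles :: "('g, 'm) monoid_scheme \<Rightarrow> nat \<Rightarrow> ('g list \<Rightarrow> real) monoid" where
  "bounded_cocycles G n = (bounded_cochains G n)
     \<lparr>carrier := kernel (bounded_cochains G n) (bounded_cochains G (n + 1)) (coboundary G n)\<rparr>"

definition bounded_coboundaries :: "('g, 'm) monoid_scheme \<Rightarrow> nat \<Rightarrow> ('g list \<Rightarrow> real) set" where
  "bounded_coboundaries G n =
     (case n of 0 \<Rightarrow> {\<one>\<^bsub>bounded_cochains G 0\<^esub>}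
      | Suc k \<Rightarrow> coboundary G k ` carrier (bounded_cochains G k))"

definition bounded_cohomology ::
    "('g, 'm) monoid_scheme \<Rightarrow> nat \<Rightarrow> ('g list \<Rightarrow> real) set monoid" where
  "bounded_cohomology G n = bounded_cocycles G n Mod bounded_coboundaries G n"

definition cohomology_class ::
    "('g, 'm) monoid_scheme \<Rightarrow> nat \<Rightarrow> ('g list \<Rightarrow> real) \<Rightarrow> ('g list \<Rightarrow> real) set" where
  "cohomology_class G n \<alpha> = bounded_coboundaries G n #>\<^bsub>bounded_cocycles G n\<^esub> \<alpha>"

definition cup_cochain :: "('g, 'm) monoid_scheme \<Rightarrow> nat \<Rightarrow> nat \<Rightarrow>
    ('g list \<Rightarrow> real) \<Rightarrow> ('g list \<Rightarrow> real) \<Rightarrow> 'g list \<Rightarrow> real" where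
  "cup_cochain G n m \<alpha> \<beta> = (\<lambda>xs\<in>tuples G (n + m). \<alpha> (take n xs) * \<beta> (drop n xs))"

text \<open>The class of the product does not depend on the representatives, so the union below is a
  union of equal cosets.\<close>

definition cup_product :: "('g, 'm) monoid_scheme \<Rightarrow> nat \<Rightarrow> nat \<Rightarrow>
    ('g list \<Rightarrow> real) set \<Rightarrow> ('g list \<Rightarrow> real) set \<Rightarrow> ('g list \<Rightarrow> real) set" where
  "cup_product G n m A B =
     (\<Union>\<alpha>\<in>A. \<Union>\<beta>\<in>B. cohomology_class G (n + m) (cup_cochain G n m \<alpha> \<beta>))"

definition one_cochain :: "('g, 'm) monoid_scheme \<Rightarrow> ('g \<Rightarrow> real) \<Rightarrow> 'g list \<Rightarrow> real" where
  "one_cochain G \<alpha> = (\<lambda>xs\<in>tuples G 1. \<alpha> (hd xs))"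

definition quasimorphism :: "('g, 'm) monoid_scheme \<Rightarrow> ('g \<Rightarrow> real) \<Rightarrow> bool" where
  "quasimorphism G \<alpha> \<longleftrightarrow> coboundary G 1 (one_cochain G \<alpha>) \<in> carrier (bounded_cochains G 2)"

definition symmetric_map :: "('g, 'm) monoid_scheme \<Rightarrow> ('g \<Rightarrow> real) \<Rightarrow> bool" where
  "symmetric_map G \<alpha> \<longleftrightarrow> (\<forall>g\<in>carrier G. \<alpha> (inv\<^bsub>G\<^esub> g) = - \<alpha> g)"


section \<open>Decompositions\<close>

definition seq_inv :: "'a set \<Rightarrow> 'a word list \<Rightarrow> 'a word list" where
  "seq_inv X gs = rev (map (\<lambda>g. inv\<^bsub>free_group X\<^esub> g) gs)"

definition seq_prod :: "'a set \<Rightarrow> 'a word list \<Rightarrow> 'a word" where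
  "seq_prod X gs = foldr (\<lambda>g h. g \<otimes>\<^bsub>free_group X\<^esub> h) gs \<one>\<^bsub>free_group X\<^esub>"

text \<open>The sequences \<open>c\<^sub>1, c\<^sub>2, c\<^sub>3\<close> and \<open>r\<^sub>1, r\<^sub>2, r\<^sub>3\<close> of the triangle of \<open>(g, h)\<close>; only the
  indices 1, 2, 3 are meaningful.  By cancellation at most one sequence \<open>r\<close> satisfies each of the
  equations in \<open>r_part\<close>; that one exists is part of the definition of a decomposition below.\<close>

definition c_part :: "'a set \<Rightarrow> ('a word \<Rightarrow> 'a word list) \<Rightarrow> 'a word \<Rightarrow> 'a word \<Rightarrow>
    nat \<Rightarrow> 'a word list" where
  "c_part X \<Delta> g h j = (let F = free_group X in seq_inv X
     (if j = 1 then longest_common_prefix (\<Delta> g) (\<Delta> (g \<otimes>\<^bsub>F\<^esub> h))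
      else if j = 2 then longest_common_prefix (\<Delta> (inv\<^bsub>F\<^esub> g)) (\<Delta> h)
      else longest_common_prefix (\<Delta> (inv\<^bsub>F\<^esub> h)) (\<Delta> (inv\<^bsub>F\<^esub> h \<otimes>\<^bsub>F\<^esub> inv\<^bsub>F\<^esub> g))))"

definition is_r_part :: "'a set \<Rightarrow> ('a word \<Rightarrow> 'a word list) \<Rightarrow> 'a word \<Rightarrow> 'a word \<Rightarrow>
    nat \<Rightarrow> 'a word list \<Rightarrow> bool" where
  "is_r_part X \<Delta> g h j r = (let F = free_group X; c = c_part X \<Delta> g h in
     if j = 1 then \<Delta> g = seq_inv X (c 1) @ r @ c 2
     else if j = 2 then \<Delta> h = seq_inv X (c 2) @ r @ c 3
     else \<Delta> (inv\<^bsub>F\<^esub> h \<otimes>\<^bsub>F\<^esub> inv\<^bsub>F\<^esub> g) = seq_inv X (c 3) @ r @ c 1)"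

definition r_part :: "'a set \<Rightarrow> ('a word \<Rightarrow> 'a word list) \<Rightarrow> 'a word \<Rightarrow> 'a word \<Rightarrow>
    nat \<Rightarrow> 'a word list" where
  "r_part X \<Delta> g h j = (THE r. is_r_part X \<Delta> g h j r)"

text \<open>In the second clause, \<open>drop i (take (Suc j) (\<Delta> g))\<close> is the subsequence of \<open>\<Delta> g\<close> from index
  \<open>i\<close> to index \<open>j\<close>, both counted from 0.\<close>

definition decomposition :: "'a set \<Rightarrow> 'a word set \<Rightarrow> ('a word \<Rightarrow> 'a word list) \<Rightarrow> bool" where
  "decomposition X P \<Delta> \<longleftrightarrow>
     (let F = free_group X in
      P \<subseteq> carrier F \<and> \<one>\<^bsub>F\<^esub> \<notin> P \<and> (\<forall>p\<in>P. inv\<^bsub>F\<^esub> p \<in> P) \<and>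
      \<Delta> \<in> carrier F \<rightarrow> lists P \<and>
      (\<forall>g\<in>carrier F. g = seq_prod X (\<Delta> g) \<and> reduced_word (concat (\<Delta> g)) \<and>
         \<Delta> (inv\<^bsub>F\<^esub> g) = seq_inv X (\<Delta> g)) \<and>
      (\<forall>g\<in>carrier F. \<forall>i j. i \<le> j \<and> j < length (\<Delta> g) \<longrightarrow>
         \<Delta> (seq_prod X (drop i (take (Suc j) (\<Delta> g)))) = drop i (take (Suc j) (\<Delta> g))) \<and>
      (\<exists>R>0::real. \<forall>g\<in>carrier F. \<forall>h\<in>carrier F. \<forall>j\<in>{1,2,3}.
         \<exists>r\<in>lists P. is_r_part X \<Delta> g h j r \<and> real (length r) \<le> R))"

definition decomposable ::
    "'a set \<Rightarrow> 'a word set \<Rightarrow> ('a word \<Rightarrow> 'a word list) \<Rightarrow> ('a word \<Rightarrow> real) \<Rightarrow> bool" where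
  "decomposable X P \<Delta> \<phi> \<longleftrightarrow>
     (\<exists>l :: 'a word \<Rightarrow> real. (\<exists>K. \<forall>p\<in>P. \<bar>l p\<bar> \<le> K) \<and>
        (\<forall>p\<in>P. l (inv\<^bsub>free_group X\<^esub> p) = - l p) \<and>
        (\<forall>g\<in>carrier (free_group X). \<phi> g = (\<Sum>p\<leftarrow>\<Delta> g. l p)))"

text \<open>For distinct pairs with equal \<open>r\<close>-parts some \<open>c\<close>-parts differ, since the parts determine
  \<open>\<Delta> g\<close> and \<open>\<Delta> h\<close>; so the numbers below are bounded and the greatest one exists.  Note that
  \<open>k\<close> counts from 0.\<close>

definition N_Delta :: "'a set \<Rightarrow> ('a word \<Rightarrow> 'a word list) \<Rightarrow>
    'a word \<times> 'a word \<Rightarrow> 'a word \<times> 'a word \<Rightarrow> enat" where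
  "N_Delta X \<Delta> = (\<lambda>(g, h) (g', h').
     if (g, h) = (g', h') then \<infinity>
     else if \<exists>j\<in>{1,2,3}. r_part X \<Delta> g h j \<noteq> r_part X \<Delta> g' h' j then 0
     else enat (GREATEST N. \<forall>j\<in>{1,2,3}.
       let c = c_part X \<Delta> g h j; c' = c_part X \<Delta> g' h' j in
       c \<noteq> c' \<longrightarrow> N \<le> min (length c) (length c') \<and> (\<forall>k<N. c ! k = c' ! k)))"

definition Delta_continuous ::
    "'a set \<Rightarrow> ('a word \<Rightarrow> 'a word list) \<Rightarrow> ('a word \<Rightarrow> real) \<Rightarrow> bool" where
  "Delta_continuous X \<Delta> \<psi> \<longleftrightarrow>
     quasimorphism (free_group X) \<psi> \<and> symmetric_map (free_group X) \<psi> \<and>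
     (\<exists>s :: nat \<Rightarrow> real. (\<forall>j. 0 \<le> s j) \<and> summable s \<and>
       (let F = free_group X; \<omega> = coboundary F 1 (one_cochain F \<psi>) in
        \<forall>g\<in>carrier F. \<forall>h\<in>carrier F. \<forall>g'\<in>carrier F. \<forall>h'\<in>carrier F. (g, h) \<noteq> (g', h') \<longrightarrow>
          \<bar>\<omega> [g, h] - \<omega> [g', h']\<bar> \<le> s (the_enat (N_Delta X \<Delta> (g, h) (g', h')))))"

end

theory Submission
  imports Defs
begin

text \<open>Let \<open>\<omega>\<close> be a bounded 2-cocycle and \<open>\<Delta>(g) = (g\<^sub>1, \<dots>, g\<^sub>k)\<close>.  Put
  \<open>\<eta>(g, h) = \<Sum>\<^sub>j \<lambda>(g\<^sub>j) (\<omega>(g\<^sub>j\<cdots>g\<^sub>k, h) + \<omega>(g\<^sub>j\<^sub>+\<^sub>1\<cdots>g\<^sub>k, h)) / 2\<close>.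
  Then \<open>\<phi> \<smile> \<omega> + \<delta>\<eta>\<close> is a bounded primitive of \<open>\<delta>\<phi> \<smile> \<omega>\<close>.  Indeed, by the cocycle identity its value at
  \<open>(g, h, i)\<close> is a signed sum of terms \<open>\<lambda>(p) (\<omega>(pz, i) + \<omega>(z, i)) / 2\<close> along the three sides of the
  triangle of \<open>(g, h)\<close>.  As each term is the mean over the two end points of \<open>p\<close>, it only
  changes sign when \<open>p\<close> is traversed backwards.  So the terms of the \<open>c\<close>-parts, which are traversed
  once in each direction, cancel, and the \<open>r\<close>-parts contribute boundedly many bounded terms.\<close>

section \<open>Sums along the suffixes of a sequence\<close>

context group
begin

lemma foldr_mult_closed:
  "set ps \<subseteq> carrier G \<Longrightarrow> b \<in> carrier G \<Longrightarrow> foldr (\<otimes>) ps b \<in> carrier G"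
  by (induction ps) auto

lemma foldr_mult_assoc:
  "set ps \<subseteq> carrier G \<Longrightarrow> b \<in> carrier G \<Longrightarrow> h \<in> carrier G \<Longrightarrow>
    foldr (\<otimes>) ps (b \<otimes> h) = foldr (\<otimes>) ps b \<otimes> h"
  by (induction ps) (auto simp: foldr_mult_closed m_assoc)

lemma inv_mult_cancel_left:
  "p \<in> carrier G \<Longrightarrow> z \<in> carrier G \<Longrightarrow> inv p \<otimes> (p \<otimes> z) = z"
  by (simp add: m_assoc[symmetric])

lemma foldr_mult_rev_inv:
  "set ps \<subseteq> carrier G \<Longrightarrow> b \<in> carrier G \<Longrightarrow>
    foldr (\<otimes>) (rev (map (m_inv G) ps)) (foldr (\<otimes>) ps b) = b"
  by (induction ps) (auto simp: foldr_mult_closed inv_mult_cancel_left)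

lemma foldr_mult_inj:
  assumes "set ps \<subseteq> carrier G" "b \<in> carrier G" "c \<in> carrier G"
    and "foldr (\<otimes>) ps b = foldr (\<otimes>) ps c"
  shows "b = c"
  using foldr_mult_rev_inv[OF assms(1,2), unfolded assms(4) foldr_mult_rev_inv[OF assms(1,3)]]
  by (rule sym)

end

text \<open>The sequence is read as a path from \<open>b\<close>, one left multiplication per entry,
  last entry first; \<open>p\<close> labels the edge from \<open>z\<close> to
  \<open>p \<otimes> z\<close>. The base point is free because in the triangle of
  \<open>(g, h)\<close> the side of \<open>g\<close> starts at \<open>h\<close>, while the sides of
  \<open>h\<close> and of the product start at the identity.\<close>

fun suffix_sum ::
    "('g, 'm) monoid_scheme \<Rightarrow> ('g \<Rightarrow> real) \<Rightarrow> ('g \<Rightarrow> real) \<Rightarrow> 'g list \<Rightarrow> 'g \<Rightarrow> real" where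
  "suffix_sum G l f [] b = 0"
| "suffix_sum G l f (p # ps) b =
     l p * (f (p \<otimes>\<^bsub>G\<^esub> foldr (\<otimes>\<^bsub>G\<^esub>) ps b) + f (foldr (\<otimes>\<^bsub>G\<^esub>) ps b)) / 2 + suffix_sum G l f ps b"

text \<open>The path along \<open>ps\<close> starts where the path along \<open>qs\<close>
  ends.\<close>

lemma suffix_sum_append:
  "suffix_sum G l f (ps @ qs) b =
    suffix_sum G l f ps (foldr (\<otimes>\<^bsub>G\<^esub>) qs b) + suffix_sum G l f qs b"
  by (induction ps) auto

context group
begin

text \<open>The reversed path starts at the old end point and retraces the same edges. The mean of
  \<open>f\<close> depends only on the unordered pair of end points, so only the sign of
  \<open>l\<close> changes; with \<open>f\<close> taken at one end point the values would
  differ.\<close>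

lemma suffix_sum_rev_inv:
  assumes "set ps \<subseteq> carrier G" "b \<in> carrier G" "\<And>p. p \<in> set ps \<Longrightarrow> l (inv p) = - l p"
  shows "suffix_sum G l f (rev (map (m_inv G) ps)) (foldr (\<otimes>) ps b) = - suffix_sum G l f ps b"
  using assms
  by (induction ps)
    (auto simp: suffix_sum_append inv_mult_cancel_left foldr_mult_closed field_simps)

text \<open>Hypothesis four is the shape of the cocycle identity, with \<open>f\<close>,
  \<open>f'\<close>, \<open>f''\<close> standing for \<omega>(-, hi), \<omega>(-, h), \<omega>(-, i)
  and \<open>c\<close> for \<omega>(h, i). The mean of the constant \<open>c\<close> is
  \<open>c\<close>, so it comes out multiplied by exactly the sum of \<open>l\<close>, which is
  \<phi>(g) for the pieces of \<open>g\<close>.\<close>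

lemma suffix_sum_diff_translate:
  assumes "set ps \<subseteq> carrier G" "b \<in> carrier G" "h \<in> carrier G"
    and "\<And>z. z \<in> carrier G \<Longrightarrow> f z - f' z + c = f'' (z \<otimes> h)"
  shows "suffix_sum G l f ps b - suffix_sum G l f' ps b + (\<Sum>p\<leftarrow>ps. l p) * c =
    suffix_sum G l f'' ps (b \<otimes> h)"
  using assms(1)
proof (induction ps)
  case (Cons p ps)
  let ?z = "foldr (\<otimes>) ps b"
  have z: "p \<in> carrier G" "?z \<in> carrier G"
    using Cons.prems assms by (auto simp: foldr_mult_closed)
  have "f'' (?z \<otimes> h) = f ?z - f' ?z + c"
    and "f'' (p \<otimes> (?z \<otimes> h)) = f (p \<otimes> ?z) - f' (p \<otimes> ?z) + c"
    using z assms(3,4) by (simp_all add: m_assoc[symmetric])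
  with Cons assms(2,3) show ?case
    by (simp add: foldr_mult_assoc) (simp add: field_simps)
qed simp

text \<open>Each edge contributes at most \<open>K * M\<close>, wherever it lies; hence short
  sequences have bounded sums, uniformly in the base point.\<close>

lemma suffix_sum_bound:
  fixes K M :: real
  assumes "set ps \<subseteq> carrier G" "b \<in> carrier G" "\<And>p. p \<in> set ps \<Longrightarrow> \<bar>l p\<bar> \<le> K" "0 \<le> K"
    and "\<And>z. z \<in> carrier G \<Longrightarrow> \<bar>f z\<bar> \<le> M"
  shows "\<bar>suffix_sum G l f ps b\<bar> \<le> length ps * (K * M)"
  using assms(1,3)
proof (induction ps)
  case (Cons p ps)
  let ?z = "foldr (\<otimes>) ps b"
  have "\<bar>f (p \<otimes> ?z)\<bar> \<le> M" "\<bar>f ?z\<bar> \<le> M"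
    using Cons.prems assms by (auto intro!: assms(5) foldr_mult_closed)
  then have "\<bar>l p * ((f (p \<otimes> ?z) + f ?z) / 2)\<bar> \<le> K * M"
    unfolding abs_mult using Cons.prems assms(4) by (intro mult_mono) auto
  moreover have "\<bar>suffix_sum G l f ps b\<bar> \<le> length ps * (K * M)"
    using Cons by simp
  ultimately show ?case
    using abs_triangle_ineq[of "l p * ((f (p \<otimes> ?z) + f ?z) / 2)" "suffix_sum G l f ps b"]
    by (simp add: distrib_right)
qed simp

end


section \<open>The triangles of a decomposition\<close>

lemma seq_inv_invol:
  assumes "set ps \<subseteq> carrier (free_group X)"
  shows "seq_inv X (seq_inv X ps) = ps"
proof -
  interpret group "free_group X" by (rule group_free_group)
  show ?thesis using assms by (auto simp: seq_inv_def rev_map intro!: map_idI)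
qed

lemma decompositionD:
  assumes "decomposition X P \<Delta>"
  shows "P \<subseteq> carrier (free_group X)"
    and "g \<in> carrier (free_group X) \<Longrightarrow> set (\<Delta> g) \<subseteq> P"
    and "g \<in> carrier (free_group X) \<Longrightarrow> seq_prod X (\<Delta> g) = g"
    and "g \<in> carrier (free_group X) \<Longrightarrow> \<Delta> (inv\<^bsub>free_group X\<^esub> g) = seq_inv X (\<Delta> g)"
proof -
  show "P \<subseteq> carrier (free_group X)"
    using assms unfolding decomposition_def Let_def by (elim conjE)
  have "\<Delta> \<in> carrier (free_group X) \<rightarrow> lists P"
    using assms unfolding decomposition_def Let_def by (elim conjE)
  then show "g \<in> carrier (free_group X) \<Longrightarrow> set (\<Delta> g) \<subseteq> P"
    by auto
  have *: "\<forall>g\<in>carrier (free_group X). g = seq_prod X (\<Delta> g) \<and> reduced_word (concat (\<Delta> g)) \<and>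
      \<Delta> (inv\<^bsub>free_group X\<^esub> g) = seq_inv X (\<Delta> g)"
    using assms unfolding decomposition_def Let_def by (elim conjE)
  show "g \<in> carrier (free_group X) \<Longrightarrow> seq_prod X (\<Delta> g) = g"
    by (rule sym, rule bspec[OF *, THEN conjunct1])
  show "g \<in> carrier (free_group X) \<Longrightarrow> \<Delta> (inv\<^bsub>free_group X\<^esub> g) = seq_inv X (\<Delta> g)"
    by (rule bspec[OF *, THEN conjunct2, THEN conjunct2])
qed

text \<open>Here \<open>a\<close> is the inverse of the first c-part, and \<open>c\<close>,
  \<open>d\<close> are the second and third. The third side is turned around to read the product
  instead of its inverse, so that \<open>a\<close> and \<open>d\<close> each occur twice in the same
  direction and only \<open>c\<close> occurs in both directions.\<close>

lemma decomposition_triangles: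
  assumes "decomposition X P \<Delta>"
  shows "\<exists>R::real. \<forall>g\<in>carrier (free_group X). \<forall>h\<in>carrier (free_group X).
      \<exists>a c d r s t. \<Delta> g = a @ r @ c \<and> \<Delta> h = seq_inv X c @ s @ d \<and>
        \<Delta> (g \<otimes>\<^bsub>free_group X\<^esub> h) = a @ t @ d \<and>
        length r \<le> R \<and> length s \<le> R \<and> length t \<le> R"
proof -
  interpret group "free_group X" by (rule group_free_group)
  note PF = decompositionD(1)[OF assms] and maps = decompositionD(2)[OF assms]
    and inv = decompositionD(4)[OF assms]
  have "\<exists>R>0::real. \<forall>g\<in>carrier (free_group X). \<forall>h\<in>carrier (free_group X). \<forall>j\<in>{1,2,3}.
      \<exists>r\<in>lists P. is_r_part X \<Delta> g h j r \<and> real (length r) \<le> R"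
    using assms unfolding decomposition_def Let_def by (elim conjE)
  then obtain R :: real where R: "\<And>g h j. g \<in> carrier (free_group X) \<Longrightarrow>
      h \<in> carrier (free_group X) \<Longrightarrow> j \<in> {1,2,3} \<Longrightarrow> \<exists>r. is_r_part X \<Delta> g h j r \<and> length r \<le> R"
    by blast
  have "\<exists>a c d r s t. \<Delta> g = a @ r @ c \<and> \<Delta> h = seq_inv X c @ s @ d \<and>
        \<Delta> (g \<otimes>\<^bsub>free_group X\<^esub> h) = a @ t @ d \<and> length r \<le> R \<and> length s \<le> R \<and> length t \<le> R"
    if g: "g \<in> carrier (free_group X)" and h: "h \<in> carrier (free_group X)" for g h
  proof -
    define c where "c = c_part X \<Delta> g h"
    from R[OF g h, of 1] obtain r where r: "\<Delta> g = seq_inv X (c 1) @ r @ c 2" "length r \<le> R"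
      by (auto simp: is_r_part_def Let_def c_def)
    from R[OF g h, of 2] obtain s where s: "\<Delta> h = seq_inv X (c 2) @ s @ c 3" "length s \<le> R"
      by (auto simp: is_r_part_def Let_def c_def)
    from R[OF g h, of 3] obtain t where
      t: "\<Delta> (inv\<^bsub>free_group X\<^esub> (g \<otimes>\<^bsub>free_group X\<^esub> h)) = seq_inv X (c 3) @ t @ c 1"
      "length t \<le> R"
      using g h by (auto simp: is_r_part_def Let_def c_def inv_mult_group)
    \<comment> \<open>Since \<Delta> commutes with inversion, inverting the third side yields the
      sequence of the product, with the order of its three blocks reversed.\<close>
    have "\<Delta> (g \<otimes>\<^bsub>free_group X\<^esub> h) = seq_inv X (seq_inv X (c 3) @ t @ c 1)"
      using inv[of "inv\<^bsub>free_group X\<^esub> (g \<otimes>\<^bsub>free_group X\<^esub> h)"] g h t(1) by simp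
    also have "\<dots> = seq_inv X (c 1) @ seq_inv X t @ seq_inv X (seq_inv X (c 3))"
      by (simp add: seq_inv_def)
    \<comment> \<open>The entries of \<open>c 3\<close> are group elements because it is a final
      segment of \<open>\<Delta> h\<close>.\<close>
    also have "seq_inv X (seq_inv X (c 3)) = c 3"
      using maps[OF h] PF s(1) by (intro seq_inv_invol) auto
    finally have "\<Delta> (g \<otimes>\<^bsub>free_group X\<^esub> h) = seq_inv X (c 1) @ seq_inv X t @ c 3" .
    moreover have "length (seq_inv X t) \<le> R" using t(2) by (simp add: seq_inv_def)
    ultimately show ?thesis using r s by blast
  qed
  then show ?thesis by blast
qed

text \<open>The sides of \<open>g\<close> and of the product share \<open>a\<close>, those of
  \<open>h\<close> and of the product share \<open>d\<close>, and \<open>c\<close> is walked back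
  and forth. All of this cancels, leaving three r-parts and the constant
  \<open>3 * R * \<bar>K\<bar>\<close>. It is chosen before \<open>f\<close>, since \<open>f\<close>
  will be \<omega>(-, i) with \<open>i\<close> varying.\<close>

lemma bounded_triangle_defect:
  fixes l :: "'a word \<Rightarrow> real"
  assumes dec: "decomposition X P \<Delta>"
    and K: "\<And>p. p \<in> P \<Longrightarrow> \<bar>l p\<bar> \<le> K"
    and l_odd: "\<And>p. p \<in> P \<Longrightarrow> l (inv\<^bsub>free_group X\<^esub> p) = - l p"
  shows "\<exists>C. \<forall>f M. (\<forall>z\<in>carrier (free_group X). \<bar>f z\<bar> \<le> M) \<longrightarrow>
      (\<forall>g\<in>carrier (free_group X). \<forall>h\<in>carrier (free_group X).
        \<bar>suffix_sum (free_group X) l f (\<Delta> g) h + suffix_sum (free_group X) l f (\<Delta> h) []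
          - suffix_sum (free_group X) l f (\<Delta> (g \<otimes>\<^bsub>free_group X\<^esub> h)) []\<bar> \<le> C * M)"
proof -
  interpret group "free_group X" by (rule group_free_group)
  let ?F = "free_group X"
  let ?prod = "foldr (\<otimes>\<^bsub>?F\<^esub>)"
  have one: "\<one>\<^bsub>?F\<^esub> = []" "[] \<in> carrier ?F" by (simp_all add: free_group_def)
  note PF = decompositionD(1)[OF dec] and maps = decompositionD(2)[OF dec]
    and prod = decompositionD(3)[OF dec, unfolded seq_prod_def one(1)]
  have PF': "\<And>ps. set ps \<subseteq> P \<Longrightarrow> set ps \<subseteq> carrier ?F" using PF by blast
  \<comment> \<open>The absolute value supplies a nonnegative bound even when \<open>P\<close> is
    empty.\<close>
  have K': "\<bar>l p\<bar> \<le> \<bar>K\<bar>" if "p \<in> P" for p using K[OF that] by linarith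
  obtain R :: real where R: "\<And>g h. g \<in> carrier ?F \<Longrightarrow> h \<in> carrier ?F \<Longrightarrow>
      \<exists>a c d r s t. \<Delta> g = a @ r @ c \<and> \<Delta> h = seq_inv X c @ s @ d \<and>
        \<Delta> (g \<otimes>\<^bsub>?F\<^esub> h) = a @ t @ d \<and> length r \<le> R \<and> length s \<le> R \<and> length t \<le> R"
    using decomposition_triangles[OF dec] by blast
  have "\<bar>suffix_sum ?F l f (\<Delta> g) h + suffix_sum ?F l f (\<Delta> h) []
        - suffix_sum ?F l f (\<Delta> (g \<otimes>\<^bsub>?F\<^esub> h)) []\<bar> \<le> 3 * R * \<bar>K\<bar> * M"
    if f: "\<And>z. z \<in> carrier ?F \<Longrightarrow> \<bar>f z\<bar> \<le> M" and g: "g \<in> carrier ?F" and h: "h \<in> carrier ?F"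
    for f M g h
  proof -
    from R[OF g h] obtain a c d r s t where
      eqs: "\<Delta> g = a @ r @ c" "\<Delta> h = seq_inv X c @ s @ d" "\<Delta> (g \<otimes>\<^bsub>?F\<^esub> h) = a @ t @ d" and
      lens: "length r \<le> R" "length s \<le> R" "length t \<le> R" by blast
    have sub: "set a \<subseteq> P" "set c \<subseteq> P" "set d \<subseteq> P" "set r \<subseteq> P" "set s \<subseteq> P" "set t \<subseteq> P"
      using maps[OF g] maps[OF h] maps[of "g \<otimes>\<^bsub>?F\<^esub> h"] g h by (auto simp: eqs)
    note subF = sub[THEN PF']
    note closed = foldr_mult_closed[OF _ one(2)] foldr_mult_closed
    have bd: "\<bar>suffix_sum ?F l f ps b\<bar> \<le> R * (\<bar>K\<bar> * M)"
      if "set ps \<subseteq> P" "b \<in> carrier ?F" "length ps \<le> R" for ps b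
    proof -
      have "\<bar>suffix_sum ?F l f ps b\<bar> \<le> length ps * (\<bar>K\<bar> * M)"
        using that PF' K' by (intro suffix_sum_bound f) auto
      also have "0 \<le> M" using f[OF one(2)] by linarith
      then have "length ps * (\<bar>K\<bar> * M) \<le> R * (\<bar>K\<bar> * M)"
        using that by (intro mult_right_mono) auto
      finally show ?thesis .
    qed
    \<comment> \<open>Both paths end at the product of \<open>g\<close> and \<open>h\<close>;
      cancelling \<open>a\<close> on the left shows that its two copies have the same base
      point.\<close>
    have "?prod a (?prod (r @ c) h) = ?prod a (?prod (t @ d) [])"
    proof -
      have "?prod (\<Delta> g) h = ?prod (\<Delta> g) (\<one>\<^bsub>?F\<^esub> \<otimes>\<^bsub>?F\<^esub> h)" using h by simp
      also have "\<dots> = ?prod (\<Delta> g) [] \<otimes>\<^bsub>?F\<^esub> h"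
        using maps[OF g] PF h one by (subst foldr_mult_assoc) auto
      also have "\<dots> = ?prod (\<Delta> (g \<otimes>\<^bsub>?F\<^esub> h)) []" using g h by (simp add: prod)
      finally show ?thesis by (simp add: eqs)
    qed
    then have outer: "?prod r (?prod c h) = ?prod t (?prod d [])"
      using foldr_mult_inj[OF subF(1), of "?prod (r @ c) h" "?prod (t @ d) []"] subF h one
      by (simp add: closed)
    \<comment> \<open>Both sides equal \<open>h\<close>; cancelling the inverse of \<open>c\<close>
      shows that walking \<open>c\<close> from \<open>h\<close> leads back to the end of
      \<open>s\<close>.\<close>
    have "?prod (seq_inv X c) (?prod c h) = ?prod (seq_inv X c) (?prod s (?prod d []))"
      using foldr_mult_rev_inv[OF subF(2) h] prod[OF h] by (simp add: eqs seq_inv_def)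
    then have inner: "?prod c h = ?prod s (?prod d [])"
      using foldr_mult_inj[of "seq_inv X c" "?prod c h" "?prod s (?prod d [])"] subF h one
      by (auto simp: closed seq_inv_def)
    have "suffix_sum ?F l f (seq_inv X c) (?prod c h) = - suffix_sum ?F l f c h"
      unfolding seq_inv_def using l_odd[OF subsetD[OF sub(2)]] by (rule suffix_sum_rev_inv[OF subF(2) h])
    then have "suffix_sum ?F l f (\<Delta> g) h + suffix_sum ?F l f (\<Delta> h) []
        - suffix_sum ?F l f (\<Delta> (g \<otimes>\<^bsub>?F\<^esub> h)) [] =
        suffix_sum ?F l f r (?prod c h) + suffix_sum ?F l f s (?prod d [])
        - suffix_sum ?F l f t (?prod d [])"
      by (simp add: eqs suffix_sum_append outer inner[symmetric])
    moreover have "\<bar>suffix_sum ?F l f r (?prod c h)\<bar> \<le> R * (\<bar>K\<bar> * M)"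
      "\<bar>suffix_sum ?F l f s (?prod d [])\<bar> \<le> R * (\<bar>K\<bar> * M)"
      "\<bar>suffix_sum ?F l f t (?prod d [])\<bar> \<le> R * (\<bar>K\<bar> * M)"
      using sub subF h one(2) lens by (auto intro!: bd closed)
    ultimately show ?thesis by (simp add: algebra_simps)
  qed
  then show ?thesis by blast
qed


section \<open>Bounded cochains in low degrees\<close>

lemma (in group) tuples_merge:
  assumes "xs \<in> tuples G (Suc n)" "1 \<le> j" "j \<le> n"
  shows "merge G j xs \<in> tuples G n"
proof -
  have "set (take (j - 1) xs) \<subseteq> carrier G" "set (drop (j + 1) xs) \<subseteq> carrier G"
    "xs ! (j - 1) \<in> carrier G" "xs ! j \<in> carrier G"
    using assms set_take_subset[of "j - 1" xs] set_drop_subset[of "j + 1" xs]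
    by (auto simp: tuples_def subset_iff)
  then show ?thesis using assms by (auto simp: merge_def tuples_def)
qed

lemma tuples_tl: "xs \<in> tuples G (Suc n) \<Longrightarrow> tl xs \<in> tuples G n"
  by (cases xs) (auto simp: tuples_def)

lemma tuples_butlast: "xs \<in> tuples G (Suc n) \<Longrightarrow> butlast xs \<in> tuples G n"
  by (auto simp: tuples_def dest: in_set_butlastD)

lemma (in group) coboundary_add:
  "coboundary G n (\<lambda>xs\<in>tuples G n. \<alpha> xs + \<beta> xs) =
    (\<lambda>xs\<in>tuples G (Suc n). coboundary G n \<alpha> xs + coboundary G n \<beta> xs)"
  by (rule ext)
    (simp add: coboundary_def tuples_merge tuples_tl tuples_butlast algebra_simps sum.distrib
      restrict_def)

lemma (in group) coboundary_bounded:
  assumes "\<alpha> \<in> carrier (bounded_cochains G n)"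
  shows "coboundary G n \<alpha> \<in> carrier (bounded_cochains G (Suc n))"
proof -
  from assms obtain K where K: "\<And>xs. xs \<in> tuples G n \<Longrightarrow> \<bar>\<alpha> xs\<bar> \<le> K"
    by (auto simp: bounded_cochains_def)
  have "\<bar>coboundary G n \<alpha> xs\<bar> \<le> K + (\<Sum>j=1..n. K) + K" if xs: "xs \<in> tuples G (Suc n)" for xs
  proof -
    have "\<bar>\<Sum>j=1..n. (- 1) ^ j * \<alpha> (merge G j xs)\<bar> \<le> (\<Sum>j=1..n. K)"
      using xs by (intro order.trans[OF sum_abs] sum_mono) (auto simp: abs_mult intro!: K tuples_merge)
    moreover have "\<bar>\<alpha> (tl xs)\<bar> \<le> K" "\<bar>(- 1) ^ (n + 1) * \<alpha> (butlast xs)\<bar> \<le> K"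
      using xs by (auto simp: abs_mult intro!: K tuples_tl tuples_butlast)
    moreover have "coboundary G n \<alpha> xs = \<alpha> (tl xs) + (\<Sum>j=1..n. (- 1) ^ j * \<alpha> (merge G j xs))
        + (- 1) ^ (n + 1) * \<alpha> (butlast xs)"
      using xs by (simp add: coboundary_def)
    ultimately show ?thesis by linarith
  qed
  then show ?thesis
    by (auto simp: bounded_cochains_def coboundary_def)
qed

lemma bounded_cochains_add:
  assumes "\<alpha> \<in> carrier (bounded_cochains G n)" "\<beta> \<in> carrier (bounded_cochains G n)"
  shows "(\<lambda>xs\<in>tuples G n. \<alpha> xs + \<beta> xs) \<in> carrier (bounded_cochains G n)"
proof -
  from assms obtain K L where "\<And>xs. xs \<in> tuples G n \<Longrightarrow> \<bar>\<alpha> xs\<bar> \<le> K"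
    "\<And>xs. xs \<in> tuples G n \<Longrightarrow> \<bar>\<beta> xs\<bar> \<le> L"
    by (auto simp: bounded_cochains_def)
  then have "\<bar>\<alpha> xs + \<beta> xs\<bar> \<le> K + L" if "xs \<in> tuples G n" for xs
    using that abs_triangle_ineq[of "\<alpha> xs" "\<beta> xs"] by (meson add_mono order.trans)
  then show ?thesis by (auto simp: bounded_cochains_def)
qed

lemma bounded_cochains_diff:
  assumes "\<alpha> \<in> carrier (bounded_cochains G n)" "\<beta> \<in> carrier (bounded_cochains G n)"
  shows "(\<lambda>xs\<in>tuples G n. \<alpha> xs - \<beta> xs) \<in> carrier (bounded_cochains G n)"
proof -
  have "(\<lambda>xs\<in>tuples G n. - \<beta> xs) \<in> carrier (bounded_cochains G n)"
    using assms(2) by (auto simp: bounded_cochains_def)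
  from bounded_cochains_add[OF assms(1) this] show ?thesis
    by (simp cong: restrict_cong)
qed

text \<open>Only in positive degree are the bounded coboundaries an image, so that the coset can be
  parametrised by bounded cochains one degree lower.\<close>

lemma cohomology_class_eq:
  "cohomology_class G (Suc n) \<alpha> =
    {\<lambda>xs\<in>tuples G (Suc n). coboundary G n \<beta> xs + \<alpha> xs | \<beta>. \<beta> \<in> carrier (bounded_cochains G n)}"
  by (auto simp: cohomology_class_def r_coset_def bounded_coboundaries_def bounded_cocycles_def
      bounded_cochains_def)

text \<open>The coset of an element of the subgroup is the subgroup itself, which is the neutral
  element of the quotient.\<close>

lemma (in group) cohomology_class_coboundary:
  assumes "\<gamma> \<in> carrier (bounded_cochains G n)"
  shows "cohomology_class G (Suc n) (coboundary G n \<gamma>) = bounded_coboundaries G (Suc n)"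
proof (intro equalityI subsetI)
  fix x assume "x \<in> cohomology_class G (Suc n) (coboundary G n \<gamma>)"
  then show "x \<in> bounded_coboundaries G (Suc n)"
    using assms
    by (auto simp: cohomology_class_eq bounded_coboundaries_def coboundary_add[symmetric]
        intro!: imageI bounded_cochains_add)
next
  fix x assume "x \<in> bounded_coboundaries G (Suc n)"
  then obtain \<alpha> where \<alpha>: "\<alpha> \<in> carrier (bounded_cochains G n)" "x = coboundary G n \<alpha>"
    by (auto simp: bounded_coboundaries_def)
  \<comment> \<open>Subtracting the primitive \<open>\<gamma>\<close> compensates for the
    representative of the coset; the sum is \<open>\<alpha>\<close> again also off the tuples, where
    both are \<open>undefined\<close>.\<close>
  let ?\<beta> = "\<lambda>xs\<in>tuples G n. \<alpha> xs - \<gamma> xs"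
  have "(\<lambda>xs\<in>tuples G n. ?\<beta> xs + \<gamma> xs) = \<alpha>"
    using \<alpha>(1) by (auto simp: bounded_cochains_def fun_eq_iff extensional_def)
  then have "x = (\<lambda>xs\<in>tuples G (Suc n). coboundary G n ?\<beta> xs + coboundary G n \<gamma> xs)"
    using \<alpha>(2) coboundary_add[of n ?\<beta> \<gamma>] by simp
  then show "x \<in> cohomology_class G (Suc n) (coboundary G n \<gamma>)"
    unfolding cohomology_class_eq using bounded_cochains_diff[OF \<alpha>(1) assms] by blast
qed

section \<open>Tuples and coboundaries written out in low degrees\<close>

lemma tuples_1: "xs \<in> tuples G (Suc 0) \<longleftrightarrow> (\<exists>g\<in>carrier G. xs = [g])"
  by (auto simp: tuples_def length_Suc_conv)

lemma tuples_2: "xs \<in> tuples G 2 \<longleftrightarrow> (\<exists>g\<in>carrier G. \<exists>h\<in>carrier G. xs = [g, h])"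
  by (auto simp: tuples_def numeral_eq_Suc length_Suc_conv)

lemma tuples_3: "xs \<in> tuples G 3 \<longleftrightarrow>
    (\<exists>g\<in>carrier G. \<exists>h\<in>carrier G. \<exists>i\<in>carrier G. xs = [g, h, i])"
  by (auto simp: tuples_def numeral_eq_Suc length_Suc_conv)

lemma tuples_4: "xs \<in> tuples G 4 \<longleftrightarrow>
    (\<exists>g\<in>carrier G. \<exists>h\<in>carrier G. \<exists>i\<in>carrier G. \<exists>k\<in>carrier G. xs = [g, h, i, k])"
  by (auto simp: tuples_def numeral_eq_Suc length_Suc_conv)

lemma coboundary_1:
  assumes "g \<in> carrier G" "h \<in> carrier G"
  shows "coboundary G 1 \<alpha> [g, h] = \<alpha> [h] - \<alpha> [g \<otimes>\<^bsub>G\<^esub> h] + \<alpha> [g]"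
  using assms by (simp add: coboundary_def merge_def tuples_def)

lemma coboundary_3:
  assumes "g \<in> carrier G" "h \<in> carrier G" "i \<in> carrier G" "k \<in> carrier G"
  shows "coboundary G 3 \<alpha> [g, h, i, k] = \<alpha> [h, i, k] - \<alpha> [g \<otimes>\<^bsub>G\<^esub> h, i, k]
    + \<alpha> [g, h \<otimes>\<^bsub>G\<^esub> i, k] - \<alpha> [g, h, i \<otimes>\<^bsub>G\<^esub> k] + \<alpha> [g, h, i]"
  using assms by (simp add: coboundary_def merge_def tuples_def numeral_eq_Suc)


section \<open>The bounded primitive\<close>

text \<open>The cup product is a union over all representatives, so each must be treated. Adding the
  coboundary of a bounded \<beta> amounts to replacing \<phi> by \<open>u\<close> = \<phi> +
  \<beta>, which stays at bounded distance from \<phi>.\<close>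

lemma (in group) quasimorphism_class_member:
  assumes "quasimorphism G \<phi>"
    and "\<alpha> \<in> cohomology_class G 2 (coboundary G 1 (one_cochain G \<phi>))"
  obtains u K M where "\<And>g. g \<in> carrier G \<Longrightarrow> \<bar>u g - \<phi> g\<bar> \<le> K"
    and "\<And>g h. g \<in> carrier G \<Longrightarrow> h \<in> carrier G \<Longrightarrow> \<alpha> [g, h] = u h - u (g \<otimes> h) + u g"
    and "\<And>g h. g \<in> carrier G \<Longrightarrow> h \<in> carrier G \<Longrightarrow> \<bar>\<alpha> [g, h]\<bar> \<le> M"
proof -
  from assms(2) obtain \<beta> where \<beta>: "\<beta> \<in> carrier (bounded_cochains G 1)" and
    \<alpha>: "\<alpha> = (\<lambda>xs\<in>tuples G 2. coboundary G 1 \<beta> xs + coboundary G 1 (one_cochain G \<phi>) xs)"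
    using cohomology_class_eq[of G 1] by (auto simp: numeral_2_eq_2)
  have "\<alpha> \<in> carrier (bounded_cochains G 2)"
    unfolding \<alpha> using coboundary_bounded[OF \<beta>] assms(1)
    by (intro bounded_cochains_add) (auto simp: quasimorphism_def numeral_2_eq_2)
  then obtain M where M: "\<And>xs. xs \<in> tuples G 2 \<Longrightarrow> \<bar>\<alpha> xs\<bar> \<le> M"
    by (auto simp: bounded_cochains_def)
  from \<beta> obtain K where K: "\<And>xs. xs \<in> tuples G 1 \<Longrightarrow> \<bar>\<beta> xs\<bar> \<le> K"
    by (auto simp: bounded_cochains_def)
  show ?thesis
  proof (rule that[of "\<lambda>g. \<beta> [g] + \<phi> g" K M])
    show "\<bar>\<beta> [g] + \<phi> g - \<phi> g\<bar> \<le> K" if "g \<in> carrier G" for g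
      using K[of "[g]"] that by (simp add: tuples_1)
    show "\<bar>\<alpha> [g, h]\<bar> \<le> M" if "g \<in> carrier G" "h \<in> carrier G" for g h
      using M[of "[g, h]"] that by (simp add: tuples_2)
    show "\<alpha> [g, h] = \<beta> [h] + \<phi> h - (\<beta> [g \<otimes> h] + \<phi> (g \<otimes> h)) + (\<beta> [g] + \<phi> g)"
      if "g \<in> carrier G" "h \<in> carrier G" for g h
      using that by (simp add: \<alpha> tuples_2 tuples_1 coboundary_1[unfolded One_nat_def] one_cochain_def)
  qed
qed

text \<open>Two terms of the coboundary of \<eta> combine with \<phi>(g) \<omega>(h, i) into the
  side of \<open>g\<close> based at \<open>h\<close>; the other two are the remaining sides of the
  triangle. The triangle defect bounds the total, although \<eta> itself need not be
  bounded.\<close>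

lemma decomposable_cup_product_bounded:
  fixes \<omega> :: "'a word \<Rightarrow> 'a word \<Rightarrow> real"
  assumes dec: "decomposition X P \<Delta>" and "decomposable X P \<Delta> \<phi>"
    and cocycle: "\<And>g h i. g \<in> carrier (free_group X) \<Longrightarrow> h \<in> carrier (free_group X) \<Longrightarrow>
      i \<in> carrier (free_group X) \<Longrightarrow>
      \<omega> h i - \<omega> (g \<otimes>\<^bsub>free_group X\<^esub> h) i + \<omega> g (h \<otimes>\<^bsub>free_group X\<^esub> i) - \<omega> g h = 0"
    and M: "\<And>g h. g \<in> carrier (free_group X) \<Longrightarrow> h \<in> carrier (free_group X) \<Longrightarrow> \<bar>\<omega> g h\<bar> \<le> M"
  shows "\<exists>\<eta> C. \<forall>g\<in>carrier (free_group X). \<forall>h\<in>carrier (free_group X). \<forall>i\<in>carrier (free_group X).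
      \<bar>\<phi> g * \<omega> h i
        + (\<eta> h i - \<eta> (g \<otimes>\<^bsub>free_group X\<^esub> h) i + \<eta> g (h \<otimes>\<^bsub>free_group X\<^esub> i) - \<eta> g h)\<bar> \<le> C"
proof -
  interpret group "free_group X" by (rule group_free_group)
  let ?F = "free_group X"
  have one: "\<one>\<^bsub>?F\<^esub> = []" "[] \<in> carrier ?F" by (simp_all add: free_group_def)
  have sub: "\<And>g. g \<in> carrier ?F \<Longrightarrow> set (\<Delta> g) \<subseteq> carrier ?F"
    using decompositionD(1,2)[OF dec] by blast
  obtain l K where K: "\<And>p. p \<in> P \<Longrightarrow> \<bar>l p\<bar> \<le> K"
    and l_odd: "\<And>p. p \<in> P \<Longrightarrow> l (inv\<^bsub>?F\<^esub> p) = - l p"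
    and \<phi>: "\<And>g. g \<in> carrier ?F \<Longrightarrow> \<phi> g = (\<Sum>p\<leftarrow>\<Delta> g. l p)"
    using assms(2) unfolding decomposable_def by blast
  obtain C where C: "\<forall>f M. (\<forall>z\<in>carrier ?F. \<bar>f z\<bar> \<le> M) \<longrightarrow> (\<forall>g\<in>carrier ?F. \<forall>h\<in>carrier ?F.
      \<bar>suffix_sum ?F l f (\<Delta> g) h + suffix_sum ?F l f (\<Delta> h) []
        - suffix_sum ?F l f (\<Delta> (g \<otimes>\<^bsub>?F\<^esub> h)) []\<bar> \<le> C * M)"
    using bounded_triangle_defect[where l = l and K = K, OF dec] K l_odd by blast
  define \<eta> where "\<eta> g h = suffix_sum ?F l (\<lambda>z. \<omega> z h) (\<Delta> g) []" for g h
  have "\<bar>\<phi> g * \<omega> h i + (\<eta> h i - \<eta> (g \<otimes>\<^bsub>?F\<^esub> h) i + \<eta> g (h \<otimes>\<^bsub>?F\<^esub> i) - \<eta> g h)\<bar> \<le> C * M"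
    if g: "g \<in> carrier ?F" and h: "h \<in> carrier ?F" and i: "i \<in> carrier ?F" for g h i
  proof -
    \<comment> \<open>The cocycle identity at \<open>(z, h, i)\<close> trades the three values of
      \<omega> for one value at \<open>z\<close> translated by \<open>h\<close>, which moves the
      base point from the identity to \<open>h\<close>.\<close>
    have "\<eta> g (h \<otimes>\<^bsub>?F\<^esub> i) - \<eta> g h + \<phi> g * \<omega> h i =
        suffix_sum ?F l (\<lambda>z. \<omega> z i) (\<Delta> g) (\<one>\<^bsub>?F\<^esub> \<otimes>\<^bsub>?F\<^esub> h)"
      unfolding \<eta>_def \<phi>[OF g] one(1)
      using cocycle[OF _ h i] by (intro suffix_sum_diff_translate sub[OF g] one(2) h) fastforce
    then show ?thesis
      using C[rule_format, of "\<lambda>z. \<omega> z i" M g h] M[OF _ i] g h by (simp add: \<eta>_def algebra_simps)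
  qed
  then show ?thesis by blast
qed

theorem theorem2:
  fixes X :: "'a set"
    and P :: "'a word set"
    and \<Delta> :: "'a word \<Rightarrow> 'a word list"
    and \<phi> \<psi> :: "'a word \<Rightarrow> real"
  assumes "\<not> comm_group (free_group X)"
    and "decomposition X P \<Delta>"
    and "quasimorphism (free_group X) \<phi>" and "decomposable X P \<Delta> \<phi>"
    and "quasimorphism (free_group X) \<psi>" and "Delta_continuous X \<Delta> \<psi>"
  shows "cup_product (free_group X) 2 2
           (cohomology_class (free_group X) 2 (coboundary (free_group X) 1 (one_cochain (free_group X) \<phi>)))
           (cohomology_class (free_group X) 2 (coboundary (free_group X) 1 (one_cochain (free_group X) \<psi>)))
         = \<one>\<^bsub>bounded_cohomology (free_group X) 4\<^esub>"
proof -
  interpret group "free_group X" by (rule group_free_group)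
  let ?F = "free_group X"
  let ?A = "\<lambda>\<phi>. cohomology_class ?F 2 (coboundary ?F 1 (one_cochain ?F \<phi>))"
  \<comment> \<open>The neutral element of the quotient is the set of bounded coboundaries, so it
    suffices to identify the class of every product of representatives with that set.\<close>
  have trivial: "cohomology_class ?F (2 + 2) (cup_cochain ?F 2 2 \<alpha> \<beta>) = bounded_coboundaries ?F 4"
    if \<alpha>: "\<alpha> \<in> ?A \<phi>" and \<beta>: "\<beta> \<in> ?A \<psi>" for \<alpha> \<beta>
  proof -
    from quasimorphism_class_member[OF assms(3) \<alpha>] obtain u K where
      u: "\<And>g. g \<in> carrier ?F \<Longrightarrow> \<bar>u g - \<phi> g\<bar> \<le> K" and
      \<alpha>_eq: "\<And>g h. g \<in> carrier ?F \<Longrightarrow> h \<in> carrier ?F \<Longrightarrow> \<alpha> [g, h] = u h - u (g \<otimes>\<^bsub>?F\<^esub> h) + u g"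
      by metis
    from quasimorphism_class_member[OF assms(5) \<beta>] obtain v M where
      \<beta>_eq: "\<And>g h. g \<in> carrier ?F \<Longrightarrow> h \<in> carrier ?F \<Longrightarrow> \<beta> [g, h] = v h - v (g \<otimes>\<^bsub>?F\<^esub> h) + v g" and
      M: "\<And>g h. g \<in> carrier ?F \<Longrightarrow> h \<in> carrier ?F \<Longrightarrow> \<bar>\<beta> [g, h]\<bar> \<le> M"
      by metis
    \<comment> \<open>\<open>\<beta>\<close> is the coboundary of \<open>v\<close>, so the identity
      telescopes; \<open>v\<close> need not be bounded for this.\<close>
    have cocycle: "\<beta> [h, i] - \<beta> [g \<otimes>\<^bsub>?F\<^esub> h, i] + \<beta> [g, h \<otimes>\<^bsub>?F\<^esub> i] - \<beta> [g, h] = 0"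
      if "g \<in> carrier ?F" "h \<in> carrier ?F" "i \<in> carrier ?F" for g h i
      using that by (simp add: \<beta>_eq m_assoc)
    have "\<exists>\<eta> C. \<forall>g\<in>carrier ?F. \<forall>h\<in>carrier ?F. \<forall>i\<in>carrier ?F.
        \<bar>\<phi> g * \<beta> [h, i] + (\<eta> h i - \<eta> (g \<otimes>\<^bsub>?F\<^esub> h) i + \<eta> g (h \<otimes>\<^bsub>?F\<^esub> i) - \<eta> g h)\<bar> \<le> C"
      using decomposable_cup_product_bounded[OF assms(2,4), of "\<lambda>g h. \<beta> [g, h]", OF cocycle M] .
    then obtain \<eta> C where \<eta>: "\<And>g h i. g \<in> carrier ?F \<Longrightarrow> h \<in> carrier ?F \<Longrightarrow> i \<in> carrier ?F \<Longrightarrow>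
        \<bar>\<phi> g * \<beta> [h, i] + (\<eta> h i - \<eta> (g \<otimes>\<^bsub>?F\<^esub> h) i + \<eta> g (h \<otimes>\<^bsub>?F\<^esub> i) - \<eta> g h)\<bar> \<le> C"
      by blast
    \<comment> \<open>This is u \<smile> \<beta> plus the coboundary of \<eta>, with
      \<open>u\<close> in place of \<phi> so that its coboundary matches the representative
      \<open>\<alpha>\<close> exactly.\<close>
    define b where
      "b g h i = u g * \<beta> [h, i] + (\<eta> h i - \<eta> (g \<otimes>\<^bsub>?F\<^esub> h) i + \<eta> g (h \<otimes>\<^bsub>?F\<^esub> i) - \<eta> g h)" for g h i
    define \<gamma> where "\<gamma> = (\<lambda>xs\<in>tuples ?F 3. b (xs ! 0) (xs ! 1) (xs ! 2))"
    have "\<bar>b g h i\<bar> \<le> K * M + C"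
      if "g \<in> carrier ?F" "h \<in> carrier ?F" "i \<in> carrier ?F" for g h i
    proof -
      \<comment> \<open>Passing from \<phi> to \<open>u\<close> changes the cochain by a bounded
        function times the bounded \<open>\<beta>\<close>.\<close>
      have "\<bar>(u g - \<phi> g) * \<beta> [h, i]\<bar> \<le> K * M"
        unfolding abs_mult using u[OF that(1)] M[OF that(2,3)] by (intro mult_mono) auto
      then show ?thesis
        using \<eta>[OF that] by (simp add: b_def algebra_simps)
    qed
    then have \<gamma>: "\<gamma> \<in> carrier (bounded_cochains ?F 3)"
      by (auto simp: bounded_cochains_def \<gamma>_def tuples_3 intro!: exI[of _ "K * M + C"])
    have "cup_cochain ?F 2 2 \<alpha> \<beta> = coboundary ?F 3 \<gamma>"
    proof (rule extensionalityI[of _ "tuples ?F 4"])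
      fix xs assume "xs \<in> tuples ?F 4"
      then obtain g h i k where xs: "xs = [g, h, i, k]" and
        mem: "g \<in> carrier ?F" "h \<in> carrier ?F" "i \<in> carrier ?F" "k \<in> carrier ?F"
        by (auto simp: tuples_4)
      have "cup_cochain ?F 2 2 \<alpha> \<beta> xs = (u h - u (g \<otimes>\<^bsub>?F\<^esub> h) + u g) * \<beta> [i, k]"
        using mem by (simp add: xs cup_cochain_def tuples_def \<alpha>_eq)
      also have "\<dots> = b h i k - b (g \<otimes>\<^bsub>?F\<^esub> h) i k + b g (h \<otimes>\<^bsub>?F\<^esub> i) k
          - b g h (i \<otimes>\<^bsub>?F\<^esub> k) + b g h i"
      proof -
        \<comment> \<open>The coefficient of \<open>u g\<close> in the coboundary of
          \<open>b\<close> is the right-hand side here, and \<open>u h\<close>,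
          \<open>u (g \<otimes> h)\<close> carry \<open>\<beta> [i, k]\<close> as well. The terms in
          \<eta> cancel by associativity.\<close>
        have "\<beta> [i, k] = \<beta> [h \<otimes>\<^bsub>?F\<^esub> i, k] - \<beta> [h, i \<otimes>\<^bsub>?F\<^esub> k] + \<beta> [h, i]"
          using cocycle[of h i k] mem by linarith
        then show ?thesis
          using mem by (simp add: b_def m_assoc) (simp add: algebra_simps)
      qed
      also have "\<dots> = coboundary ?F 3 \<gamma> xs"
        using mem by (simp add: xs coboundary_3 \<gamma>_def tuples_def)
      finally show "cup_cochain ?F 2 2 \<alpha> \<beta> xs = coboundary ?F 3 \<gamma> xs" .
    qed (auto simp: cup_cochain_def coboundary_def)
    then show ?thesis
      using cohomology_class_coboundary[OF \<gamma>] by simp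
  qed
  \<comment> \<open>A union over an empty set of representatives would be empty instead of the
    neutral coset; the zero cochain provides a representative.\<close>
  have "?A \<phi> \<noteq> {}" for \<phi>
  proof -
    have "(\<lambda>xs\<in>tuples ?F 1. 0) \<in> carrier (bounded_cochains ?F 1)"
      by (auto simp: bounded_cochains_def)
    then show ?thesis using cohomology_class_eq[of ?F 1] by (auto simp: numeral_2_eq_2)
  qed
  then have "cup_product ?F 2 2 (?A \<phi>) (?A \<psi>) = bounded_coboundaries ?F 4"
    unfolding cup_product_def using trivial by (simp cong: SUP_cong)
  then show ?thesis by (simp add: bounded_cohomology_def FactGroup_def)
qed

end
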